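(* Let $(M,h)$ be a Lorentzian manifold of dimension $2n\ge 4$. Locally about any point of $M$, let $h_{PW}$ be a plane wave limit of $h$ (in the sense of Penrose), and express it in local coordinates $(v,u,x^3,\dots,x^{2n})$ in which $$h_{PW}=H(u,x^3,\dots,x^{2n})\,du^2+2\,dv\,du+\sum_{i=3}^{2n}(dx^i)^2 ,$$ with $H$ a smooth function independent of $v$ (and a quadratic polynomial in $x^3,\dots,x^{2n}$ for each $u$). Let $T=\tfrac12(H+1)\partial_v-\partial_u$ and let $g=h_{PW}+2T^\flat\otimes T^\flat$, with $T^\flat=h_{PW}(T,\cdot)$, be the standard Riemannian dual of $h_{PW}$ in these coordinates. Then $g$ admits an almost Kähler structure, namely the almost complex structure $J$ determined by $JT=Z$, $JZ=-T$ and $J\partial_{x^{2k-1}}=\partial_{x^{2k}}$, $J\partial_{x^{2k}}=-\partial_{x^{2k-1}}$ for $k=2,\dots,n$, where $Z=\tfrac12(H-1)\partial_v-\partial_u$: $J$ is compatible with $g$ and the 2-form $\omega=g(\cdot,J\cdot)$ is closed.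
   Context: Lorentzian metrics have signature $(-,+,\dots,+)$. $dv\,du$ denotes the symmetric product, so $h_{PW}(\partial_v,\partial_u)=1$. Penrose's plane wave limit. About any point of $M$ there is a locally defined nowhere zero lightlike gradient field $N=\mathrm{grad}_h f$, $h(N,N)=0$, and local coordinates $(x^0,x^1,\dots,x^{2n-1})$ centered at the point with $N=\partial/\partial x^0$ and $h(\partial_0,\partial_0)=0$, $h(\partial_0,\partial_1)=1$, $h(\partial_0,\partial_a)=0$ for $a\ge2$; the remaining components $h_{ij}$ ($i,j\ge1$) are functions of all the coordinates. For a constant $\Omega>0$ let $\varphi$ be the rescaling $(x^0,x^1,x^2,\dots,x^{2n-1})\mapsto(\tilde x^0,\tilde x^1,\dots,\tilde x^{2n-1})=(x^0,\Omega^{-2}x^1,\Omega^{-1}x^2,\dots,\Omega^{-1}x^{2n-1})$, and set $h_\Omega=\Omega^{-2}(\varphi^{-1})^*h$. The plane wave limit (depending on the choice of $N$ and coordinates) is $$h_{PW}=\lim_{\Omega\to0}h_\Omega=2\,d\tilde x^0d\tilde x^1+\sum_{a,b\ge2}h_{ab}(\tilde x^0,0,\dots,0)\,d\tilde x^a d\tilde x^b .$$ It is a known fact that this metric is locally isometric to a plane wave, i.e. admits coordinates $(v,u,x^3,\dots,x^{2n})$ in which it has the form $H\,du^2+2\,dv\,du+\sum_i(dx^i)^2$ with $H=H(u,x^3,\dots,x^{2n})$ quadratic in the $x^i$. An almost complex structure $J$ is a smooth endomorphism of the tangent bundle with $J^2=-1$; it is compatible with $g$ if $g(J\cdot,J\cdot)=g$.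 A Riemannian metric with compatible $J$ is almost Kähler if the fundamental 2-form $\omega=g(\cdot,J\cdot)$ is closed. *)

theory Defs
  imports "HOL-Analysis.Analysis"
begin

section \<open>Smooth maps and tensor fields on open subsets of a Euclidean space\<close>

text \<open>Both notions are meant for open sets \<open>S\<close>. The directions \<open>v\<close> are constant, so the
  recursion runs through all iterated directional derivatives.\<close>

primrec Ck_on :: "nat \<Rightarrow> 'a::real_normed_vector set \<Rightarrow> ('a \<Rightarrow> 'b::real_normed_vector) \<Rightarrow> bool" where
  "Ck_on 0 S f \<longleftrightarrow> continuous_on S f"
| "Ck_on (Suc k) S f \<longleftrightarrow>
     (\<forall>x\<in>S. f differentiable (at x)) \<and> (\<forall>v. Ck_on k S (\<lambda>x. frechet_derivative f (at x) v))"

definition smooth_on :: "'a::real_normed_vector set \<Rightarrow> ('a \<Rightarrow> 'b::real_normed_vector) \<Rightarrow> bool" where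
  "smooth_on S f \<longleftrightarrow> (\<forall>k. Ck_on k S f)"

text \<open>A field of bilinear forms; tangent vectors at a point of the space \<open>'a\<close> are elements of \<open>'a\<close>.\<close>

type_synonym 'a bilinear_field = "'a \<Rightarrow> 'a \<Rightarrow> 'a \<Rightarrow> real"

definition smooth_bilinear_field_on :: "'a::real_normed_vector set \<Rightarrow> 'a bilinear_field \<Rightarrow> bool" where
  "smooth_bilinear_field_on S b \<longleftrightarrow>
     (\<forall>x\<in>S. bilinear (b x)) \<and> (\<forall>v w. smooth_on S (\<lambda>x. b x v w))"

definition pullback_form ::
  "('a::real_normed_vector \<Rightarrow> 'b::real_normed_vector) \<Rightarrow> 'b bilinear_field \<Rightarrow> 'a bilinear_field" where
  "pullback_form F b x v w =
     b (F x) (frechet_derivative F (at x) v) (frechet_derivative F (at x) w)"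

definition smooth_symmetric_on :: "'a::real_normed_vector set \<Rightarrow> 'a bilinear_field \<Rightarrow> bool" where
  "smooth_symmetric_on S b \<longleftrightarrow>
     smooth_bilinear_field_on S b \<and> (\<forall>x\<in>S. \<forall>v w. b x v w = b x w v)"

definition riemannian_metric_on :: "'a::real_normed_vector set \<Rightarrow> 'a bilinear_field \<Rightarrow> bool" where
  "riemannian_metric_on S g \<longleftrightarrow>
     smooth_symmetric_on S g \<and> (\<forall>x\<in>S. \<forall>v. v \<noteq> 0 \<longrightarrow> 0 < g x v v)"

text \<open>Signature \<open>(-,+,\<dots>,+)\<close>: there is an orthonormal frame, indexed by the coordinates, with
  exactly one negative vector. Such a family has an invertible Gram matrix, hence is a basis.\<close>

definition lorentzian_form :: "(real^'d \<Rightarrow> real^'d \<Rightarrow> real) \<Rightarrow> bool" where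
  "lorentzian_form B \<longleftrightarrow>
     (\<exists>(e :: 'd \<Rightarrow> real^'d) k. \<forall>i j. B (e i) (e j) = (if i \<noteq> j then 0 else if i = k then - 1 else 1))"

definition lorentzian_metric_on :: "(real^'d) set \<Rightarrow> (real^'d) bilinear_field \<Rightarrow> bool" where
  "lorentzian_metric_on S b \<longleftrightarrow> smooth_symmetric_on S b \<and> (\<forall>x\<in>S. lorentzian_form (b x))"

text \<open>\<open>N\<close> is the gradient of \<open>f\<close>: \<open>b(N, \<cdot>) = df\<close>.\<close>

definition is_gradient_on ::
  "'a::real_normed_vector set \<Rightarrow> 'a bilinear_field \<Rightarrow> ('a \<Rightarrow> real) \<Rightarrow> ('a \<Rightarrow> 'a) \<Rightarrow> bool" where
  "is_gradient_on S b f N \<longleftrightarrow> (\<forall>x\<in>S. \<forall>w. b x (N x) w = frechet_derivative f (at x) w)"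

text \<open>For constant vector fields the Lie bracket terms of the exterior derivative vanish.\<close>

definition ext_deriv2 :: "'a::real_normed_vector bilinear_field \<Rightarrow> 'a \<Rightarrow> 'a \<Rightarrow> 'a \<Rightarrow> 'a \<Rightarrow> real" where
  "ext_deriv2 \<omega> x a b c =
     frechet_derivative (\<lambda>y. \<omega> y b c) (at x) a
   - frechet_derivative (\<lambda>y. \<omega> y a c) (at x) b
   + frechet_derivative (\<lambda>y. \<omega> y a b) (at x) c"

definition closed_two_form_on :: "'a::real_normed_vector set \<Rightarrow> 'a bilinear_field \<Rightarrow> bool" where
  "closed_two_form_on S \<omega> \<longleftrightarrow>
     smooth_bilinear_field_on S \<omega> \<and> (\<forall>x\<in>S. \<forall>v. \<omega> x v v = 0) \<and>
     (\<forall>x\<in>S. \<forall>a b c. ext_deriv2 \<omega> x a b c = 0)"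

definition almost_complex_structure_on :: "'a::real_normed_vector set \<Rightarrow> ('a \<Rightarrow> 'a \<Rightarrow> 'a) \<Rightarrow> bool" where
  "almost_complex_structure_on S J \<longleftrightarrow>
     (\<forall>x\<in>S. linear (J x)) \<and> (\<forall>v. smooth_on S (\<lambda>x. J x v)) \<and> (\<forall>x\<in>S. \<forall>v. J x (J x v) = - v)"

definition compatible_on ::
  "'a::real_normed_vector set \<Rightarrow> 'a bilinear_field \<Rightarrow> ('a \<Rightarrow> 'a \<Rightarrow> 'a) \<Rightarrow> bool" where
  "compatible_on S g J \<longleftrightarrow> (\<forall>x\<in>S. \<forall>v w. g x (J x v) (J x w) = g x v w)"

definition fundamental_form :: "'a bilinear_field \<Rightarrow> ('a \<Rightarrow> 'a \<Rightarrow> 'a) \<Rightarrow> 'a bilinear_field" where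
  "fundamental_form g J x v w = g x v (J x w)"

definition almost_kaehler_on ::
  "'a::real_normed_vector set \<Rightarrow> 'a bilinear_field \<Rightarrow> ('a \<Rightarrow> 'a \<Rightarrow> 'a) \<Rightarrow> bool" where
  "almost_kaehler_on S g J \<longleftrightarrow>
     riemannian_metric_on S g \<and> almost_complex_structure_on S J \<and> compatible_on S g J \<and>
     closed_two_form_on S (fundamental_form g J)"


section \<open>Smooth manifolds and Lorentzian metrics\<close>

text \<open>A chart is a pair of its domain and its coordinate map; the values of the map outside the
  domain are irrelevant.\<close>

type_synonym ('m, 'd) chart = "'m set \<times> ('m \<Rightarrow> real^'d)"

definition is_chart :: "'m topology \<Rightarrow> ('m, 'd::finite) chart \<Rightarrow> bool" where
  "is_chart X c \<longleftrightarrow>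
     openin X (fst c) \<and> open (snd c ` fst c) \<and>
     homeomorphic_map (subtopology X (fst c)) (top_of_set (snd c ` fst c)) (snd c)"

definition overlap :: "('m, 'd::finite) chart \<Rightarrow> ('m, 'd) chart \<Rightarrow> (real^'d) set" where
  "overlap c c' = snd c ` (fst c \<inter> fst c')"

definition transition :: "('m, 'd::finite) chart \<Rightarrow> ('m, 'd) chart \<Rightarrow> real^'d \<Rightarrow> real^'d" where
  "transition c c' = snd c' \<circ> inv_into (fst c) (snd c)"

definition charts_compatible :: "('m, 'd::finite) chart \<Rightarrow> ('m, 'd) chart \<Rightarrow> bool" where
  "charts_compatible c c' \<longleftrightarrow>
     smooth_on (overlap c c') (transition c c') \<and> smooth_on (overlap c' c) (transition c' c)"

text \<open>The set \<open>A\<close> is a maximal atlas.\<close>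

definition smooth_manifold :: "'m topology \<Rightarrow> ('m, 'd::finite) chart set \<Rightarrow> bool" where
  "smooth_manifold X A \<longleftrightarrow>
     Hausdorff_space X \<and> second_countable X \<and>
     (\<forall>c\<in>A. is_chart X c) \<and> (\<Union>c\<in>A. fst c) = topspace X \<and>
     (\<forall>c\<in>A. \<forall>c'\<in>A. charts_compatible c c') \<and>
     (\<forall>c. is_chart X c \<and> (\<forall>c'\<in>A. charts_compatible c c') \<longrightarrow> c \<in> A)"

text \<open>A metric on a manifold is given by its coordinate representations: \<open>h c\<close> is the metric in the
  chart \<open>c\<close>, a field of bilinear forms on the image of \<open>c\<close>, and the representations in different
  charts are related by the transformation law of covariant 2-tensors.\<close>

definition lorentzian_manifold ::
  "'m topology \<Rightarrow> ('m, 'd::finite) chart set \<Rightarrow> (('m, 'd) chart \<Rightarrow> (real^'d) bilinear_field) \<Rightarrow> bool" where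
  "lorentzian_manifold X A h \<longleftrightarrow>
     smooth_manifold X A \<and>
     (\<forall>c\<in>A. lorentzian_metric_on (snd c ` fst c) (h c)) \<and>
     (\<forall>c\<in>A. \<forall>c'\<in>A. \<forall>x\<in>overlap c c'. h c x = pullback_form (transition c c') (h c') x)"


section \<open>Plane wave limits\<close>

text \<open>Coordinates of a manifold of dimension \<open>2n\<close>, \<open>n = CARD('n)\<close>, are indexed by the type
  \<open>'n bit0\<close> of integers modulo \<open>2n\<close>; the index \<open>of_nat k\<close> with \<open>k < 2n\<close> is the \<open>k\<close>-th
  coordinate, counted from 0. In particular \<open>x $ 0\<close> and \<open>x $ 1\<close> are the Penrose coordinates
  \<open>x\<^sup>0\<close>, \<open>x\<^sup>1\<close>.

  Functions and vector fields on the domain of the chart are written in its coordinates, that is, on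
  the image of the chart.\<close>

definition penrose_coordinates ::
  "('m, 'n bit0) chart set \<Rightarrow> (('m, 'n::finite bit0) chart \<Rightarrow> (real^('n bit0)) bilinear_field)
    \<Rightarrow> 'm \<Rightarrow> ('m, 'n bit0) chart \<Rightarrow> bool" where
  "penrose_coordinates A h p c \<longleftrightarrow>
     c \<in> A \<and> p \<in> fst c \<and> snd c p = 0 \<and>
     (\<exists>f N. smooth_on (snd c ` fst c) f \<and>
        is_gradient_on (snd c ` fst c) (h c) f N \<and>
        (\<forall>x \<in> snd c ` fst c.
           N x \<noteq> 0 \<and> h c x (N x) (N x) = 0 \<and> N x = axis 0 1)) \<and>
     (\<forall>x \<in> snd c ` fst c.
        h c x (axis 0 1) (axis 0 1) = 0 \<and>
        h c x (axis 0 1) (axis 1 1) = 1 \<and>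
        (\<forall>a. a \<noteq> 0 \<and> a \<noteq> 1 \<longrightarrow> h c x (axis 0 1) (axis a 1) = 0))"

definition penrose_rescaling :: "real \<Rightarrow> real^('n::finite bit0) \<Rightarrow> real^('n bit0)" where
  "penrose_rescaling \<Omega> x =
     (\<chi> i. if i = 0 then x $ i else if i = 1 then x $ i / \<Omega>\<^sup>2 else x $ i / \<Omega>)"

definition rescaled_metric ::
  "(real^('n::finite bit0)) bilinear_field \<Rightarrow> real \<Rightarrow> (real^('n bit0)) bilinear_field" where
  "rescaled_metric b \<Omega> x v w = pullback_form (inv (penrose_rescaling \<Omega>)) b x v w / \<Omega>\<^sup>2"

text \<open>For a metric on \<open>V\<close> the rescaled metric lives on the image of \<open>V\<close> under the rescaling. As
  \<open>\<Omega>\<close> tends to 0, these images eventually contain every point \<open>x\<close> for which \<open>(x\<^sup>0, 0, \<dots>, 0)\<close>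
  lies in \<open>V\<close>; these points form the domain of the limit.\<close>

definition limit_domain :: "(real^('n::finite bit0)) set \<Rightarrow> (real^('n bit0)) set" where
  "limit_domain V = {x. axis 0 (x $ 0) \<in> V}"

text \<open>\<open>hPW\<close>, a metric on \<open>D\<close>, is a plane wave limit of \<open>h\<close> about the point \<open>p\<close>.\<close>

definition plane_wave_limit ::
  "('m, 'n bit0) chart set \<Rightarrow> (('m, 'n::finite bit0) chart \<Rightarrow> (real^('n bit0)) bilinear_field)
    \<Rightarrow> 'm \<Rightarrow> (real^('n bit0)) set \<Rightarrow> (real^('n bit0)) bilinear_field \<Rightarrow> bool" where
  "plane_wave_limit A h p D hPW \<longleftrightarrow>
     (\<exists>c. penrose_coordinates A h p c \<and> D = limit_domain (snd c ` fst c) \<and>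
        (\<forall>x\<in>D. \<forall>v w. ((\<lambda>\<Omega>. rescaled_metric (h c) \<Omega> x v w) \<longlongrightarrow> hPW x v w) (at_right 0)))"


section \<open>Plane wave coordinates, the Riemannian dual and the almost complex structure\<close>

text \<open>The coordinates \<open>(v, u, x\<^sup>3, \<dots>, x\<^sup>2\<^sup>n)\<close>: \<open>v\<close> has index 0, \<open>u\<close> has index 1 and \<open>x\<^sup>j\<close>
  has index \<open>j - 1\<close>.\<close>

definition partial_v :: "real^('n::finite bit0)" where
  "partial_v = axis 0 1"

definition partial_u :: "real^('n::finite bit0)" where
  "partial_u = axis 1 1"

definition partial_x :: "nat \<Rightarrow> real^('n::finite bit0)" where
  "partial_x j = axis (of_nat (j - 1)) 1"

text \<open>\<open>H du\<^sup>2 + 2 dv du + \<Sum> (dx\<^sup>i)\<^sup>2\<close>, where \<open>dv du\<close> is normalised so that \<open>2 dv du\<close> takes the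
  value 1 on \<open>(\<partial>\<^sub>v, \<partial>\<^sub>u)\<close>.\<close>

definition pw_metric :: "(real^('n::finite bit0) \<Rightarrow> real) \<Rightarrow> (real^('n bit0)) bilinear_field" where
  "pw_metric H x a b =
     H x * (a $ 1 * b $ 1) + (a $ 0 * b $ 1 + a $ 1 * b $ 0) + (\<Sum>i\<in>-{0,1}. a $ i * b $ i)"

definition pw_profile :: "(real^('n::finite bit0)) set \<Rightarrow> (real^('n bit0) \<Rightarrow> real) \<Rightarrow> bool" where
  "pw_profile W H \<longleftrightarrow>
     smooth_on W H \<and>
     (\<forall>x\<in>W. \<forall>y\<in>W. (\<forall>i. i \<noteq> 0 \<longrightarrow> x $ i = y $ i) \<longrightarrow> H x = H y) \<and>
     (\<forall>u. \<exists>q l c. \<forall>x\<in>W. x $ 1 = u \<longrightarrow>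
        H x = (\<Sum>i\<in>-{0,1}. \<Sum>j\<in>-{0,1}. q i j * x $ i * x $ j) + (\<Sum>i\<in>-{0,1}. l i * x $ i) + c)"

text \<open>\<open>\<psi>\<close> is a coordinate system on the open subset \<open>E\<close> of the domain \<open>D\<close> of \<open>hPW\<close>, with image
  \<open>W\<close>, in which \<open>hPW\<close> is a plane wave with profile \<open>H\<close>.\<close>

definition plane_wave_coordinates ::
  "(real^('n::finite bit0)) set \<Rightarrow> (real^('n bit0)) bilinear_field \<Rightarrow> (real^('n bit0)) set
    \<Rightarrow> (real^('n bit0) \<Rightarrow> real^('n bit0)) \<Rightarrow> (real^('n bit0)) set \<Rightarrow> (real^('n bit0) \<Rightarrow> real) \<Rightarrow> bool" where
  "plane_wave_coordinates D hPW E \<psi> W H \<longleftrightarrow>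
     open E \<and> E \<subseteq> D \<and> open W \<and> bij_betw \<psi> E W \<and>
     smooth_on E \<psi> \<and> smooth_on W (inv_into E \<psi>) \<and>
     pw_profile W H \<and>
     (\<forall>x\<in>E. hPW x = pullback_form \<psi> (pw_metric H) x)"

definition pw_T :: "(real^('n::finite bit0) \<Rightarrow> real) \<Rightarrow> real^('n bit0) \<Rightarrow> real^('n bit0)" where
  "pw_T H x = ((H x + 1) / 2) *\<^sub>R partial_v - partial_u"

definition pw_Z :: "(real^('n::finite bit0) \<Rightarrow> real) \<Rightarrow> real^('n bit0) \<Rightarrow> real^('n bit0)" where
  "pw_Z H x = ((H x - 1) / 2) *\<^sub>R partial_v - partial_u"

definition flat :: "'a bilinear_field \<Rightarrow> ('a \<Rightarrow> 'a) \<Rightarrow> 'a \<Rightarrow> 'a \<Rightarrow> real" where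
  "flat b T x v = b x (T x) v"

definition riemannian_dual :: "'a bilinear_field \<Rightarrow> ('a \<Rightarrow> 'a) \<Rightarrow> 'a bilinear_field" where
  "riemannian_dual b T x v w = b x v w + 2 * (flat b T x v * flat b T x w)"

definition frame_endomorphism ::
  "(real^('n::finite bit0)) set \<Rightarrow> (real^('n bit0) \<Rightarrow> real)
    \<Rightarrow> (real^('n bit0) \<Rightarrow> real^('n bit0) \<Rightarrow> real^('n bit0)) \<Rightarrow> bool" where
  "frame_endomorphism W H J \<longleftrightarrow>
     (\<forall>x\<in>W. linear (J x) \<and> J x (pw_T H x) = pw_Z H x \<and> J x (pw_Z H x) = - pw_T H x \<and>
        (\<forall>k\<in>{2..CARD('n)}. J x (partial_x (2*k-1)) = partial_x (2*k) \<and>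
                            J x (partial_x (2*k)) = - partial_x (2*k-1)))"

end

theory Submission
  imports Defs
begin

text \<open>In the coordinate frame the fundamental form \<open>g(\<cdot>, J\<cdot>)\<close> is
  \<open>dv \<and> du - \<Sum> dx\<^sup>2\<^sup>k\<^sup>-\<^sup>1 \<and> dx\<^sup>2\<^sup>k\<close>: the profile \<open>H\<close> cancels, so the form has constant
  coefficients and is closed. Indeed \<open>\<partial>\<^sub>v = T - Z\<close> and \<open>\<partial>\<^sub>u = (H - 1)/2 T - (H + 1)/2 Z\<close>, where
  \<open>T, Z, \<partial>\<^sub>3, \<dots>\<close> is a \<open>g\<close>-orthonormal frame; the change from \<open>T, Z\<close> to \<open>\<partial>\<^sub>v, \<partial>\<^sub>u\<close> has determinant
  of absolute value 1.\<close>

section \<open>Smooth maps\<close>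

text \<open>At a point of the open set \<open>S\<close> the derivative sees only values on
  \<open>S\<close>, so agreement there passes to every iterated directional derivative.\<close>

lemma Ck_on_cong:
  assumes "open S" "\<And>x. x \<in> S \<Longrightarrow> f x = g x" "Ck_on k S f"
  shows "Ck_on k S g"
  using assms(2,3)
proof (induction k arbitrary: f g)
  case 0
  then show ?case by (simp cong: continuous_on_cong)
next
  case (Suc k)
  have deriv: "(g has_derivative frechet_derivative f (at x)) (at x)" if "x \<in> S" for x
    using has_derivative_transform_within_open[OF _ assms(1) that] Suc.prems that
    by (metis Ck_on.simps(2) frechet_derivative_works)
  have "Ck_on k S (\<lambda>x. frechet_derivative g (at x) v)" for v
  proof (rule Suc.IH)
    show "Ck_on k S (\<lambda>x. frechet_derivative f (at x) v)"
      using Suc.prems by simp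
  qed (metis deriv frechet_derivative_at)
  with deriv show ?case by (auto simp: differentiable_def)
qed

lemma Ck_on_SucD: "Ck_on (Suc k) S f \<Longrightarrow> Ck_on k S f"
proof (induction k arbitrary: f)
  case 0
  then show ?case
    by (auto intro!: continuous_at_imp_continuous_on differentiable_imp_continuous_within)
qed auto

text \<open>Lets an explicit derivative stand in for \<open>frechet_derivative\<close>, so that sums
  and products follow the usual rules.\<close>

lemma Ck_on_SucI:
  assumes "open S" "\<And>x. x \<in> S \<Longrightarrow> (f has_derivative f' x) (at x)"
    and "\<And>v. Ck_on k S (\<lambda>x. f' x v)"
  shows "Ck_on (Suc k) S f"
proof -
  have "Ck_on k S (\<lambda>x. frechet_derivative f (at x) v)" for v
    by (rule Ck_on_cong[OF assms(1) _ assms(3)[of v]]) (metis assms(2) frechet_derivative_at)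
  with assms(2) show ?thesis by (auto simp: differentiable_def)
qed

lemma Ck_on_const: "open S \<Longrightarrow> Ck_on k S (\<lambda>x. c)"
  by (induction k arbitrary: c)
    (auto intro: Ck_on_SucI[where f' = "\<lambda>x v. 0"] simp del: Ck_on.simps(2))

lemma Ck_on_add:
  assumes "open S" "Ck_on k S f" "Ck_on k S g"
  shows "Ck_on k S (\<lambda>x. f x + g x)"
  using assms(2,3)
proof (induction k arbitrary: f g)
  case 0
  then show ?case by (simp add: continuous_on_add)
next
  case (Suc k)
  show ?case
  proof (rule Ck_on_SucI[OF assms(1)])
    show "((\<lambda>x. f x + g x) has_derivative
        (\<lambda>v. frechet_derivative f (at x) v + frechet_derivative g (at x) v)) (at x)"
      if "x \<in> S" for x
      using Suc.prems that by (auto intro!: has_derivative_add simp: frechet_derivative_works)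
  qed (use Suc in auto)
qed

lemma Ck_on_bounded_bilinear:
  assumes "bounded_bilinear B" "open S" "Ck_on k S f" "Ck_on k S g"
  shows "Ck_on k S (\<lambda>x. B (f x) (g x))"
  using assms(3,4)
proof (induction k arbitrary: f g)
  case 0
  then show ?case by (simp add: bounded_bilinear.continuous_on[OF assms(1)])
next
  case (Suc k)
  show ?case
  proof (rule Ck_on_SucI[OF assms(2)])
    show "((\<lambda>x. B (f x) (g x)) has_derivative
        (\<lambda>v. B (f x) (frechet_derivative g (at x) v) + B (frechet_derivative f (at x) v) (g x))) (at x)"
      if "x \<in> S" for x
      using Suc.prems that
      by (auto intro!: bounded_bilinear.FDERIV[OF assms(1)] simp: frechet_derivative_works)
    show "Ck_on k S (\<lambda>x. B (f x) (frechet_derivative g (at x) v) +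
        B (frechet_derivative f (at x) v) (g x))" for v
      \<comment> \<open>The Leibniz rule leaves one factor undifferentiated;
        \<open>Ck_on_SucD\<close> lowers it to order \<open>k\<close> for the induction
        hypothesis.\<close>
      using Suc.prems Suc.prems[THEN Ck_on_SucD] by (intro Ck_on_add[OF assms(2)] Suc.IH) auto
  qed
qed

lemma smooth_on_const: "open S \<Longrightarrow> smooth_on S (\<lambda>x. c)"
  by (simp add: smooth_on_def Ck_on_const)

text \<open>Tailored to the dual metric and to \<open>pw_J\<close>, whose coordinate components are
  polynomials of degree at most 2 in \<open>H\<close>.\<close>

lemma smooth_on_quadratic:
  fixes f :: "'a::real_normed_vector \<Rightarrow> real"
  assumes "open S" "smooth_on S f"
  shows "smooth_on S (\<lambda>x. (f x * f x) *\<^sub>R a + f x *\<^sub>R b + c)"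
  unfolding smooth_on_def
  using assms
  by (intro allI Ck_on_add Ck_on_bounded_bilinear[OF bounded_bilinear_scaleR]
      Ck_on_bounded_bilinear[OF bounded_bilinear_mult] Ck_on_const)
    (auto simp: smooth_on_def)


section \<open>Parity of coordinate indices\<close>

definition even_index :: "'n::finite bit0 \<Rightarrow> bool" where
  "even_index i \<longleftrightarrow> even (Rep_bit0 i)"

lemma even_index_0: "even_index (0 :: 'n::finite bit0)"
  by (simp add: even_index_def bit0.Rep_0)

text \<open>The modulus 2n is even, so reduction modulo 2n keeps parity, also at the wraparound from
  2n - 1 to 0.\<close>

lemma even_index_add1: "even_index (i + 1) \<longleftrightarrow> \<not> even_index (i :: 'n::finite bit0)"
  by (simp add: even_index_def plus_bit0_def Abs_bit0'_def bit0.Rep_Abs_mod bit0.Rep_1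
      dvd_mod_iff del: card_bit0) (simp add: dvd_mod_iff)

lemma even_index_diff1: "even_index (i - 1) \<longleftrightarrow> \<not> even_index (i :: 'n::finite bit0)"
  using even_index_add1[of "i - 1"] by simp

lemma even_index_of_nat: "even_index (of_nat m :: 'n::finite bit0) \<longleftrightarrow> even m"
  by (induction m) (simp_all add: even_index_0 even_index_add1 add.commute[of 1])

lemma bit0_of_nat_surj:
  fixes i :: "'n::finite bit0"
  obtains m where "m < 2 * CARD('n)" "i = of_nat m"
proof (cases i rule: bit0.cases)
  case (1 z)
  then show ?thesis by (intro that[of "nat z"]) auto
qed

text \<open>Counted from 0, each of the pairs (v, u) and (x^(2k-1), x^(2k)) consists of an even
  index and its successor.\<close>

definition partner :: "'n::finite bit0 \<Rightarrow> 'n bit0" where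
  "partner i = (if even_index i then i + 1 else i - 1)"

text \<open>The sign belongs to components: where J sends e_i to e_(i+1) with i even, (J w)_i = -
  w_(i+1).\<close>

definition partner_sign :: "'n::finite bit0 \<Rightarrow> real" where
  "partner_sign i = (if even_index i then - 1 else 1)"

lemma partner_partner [simp]: "partner (partner i) = i"
  by (simp add: partner_def even_index_add1 even_index_diff1)

lemma partner_sign_partner [simp]: "partner_sign (partner i) = - partner_sign i"
  by (simp add: partner_def partner_sign_def even_index_add1 even_index_diff1)

lemma partner_sign_square [simp]:
  "partner_sign i * partner_sign i = 1" "partner_sign i * (partner_sign i * c) = c"
  by (simp_all add: partner_sign_def)

lemma partner_0: "partner 0 = 1"
  by (simp add: partner_def even_index_0)

lemma partner_1: "partner 1 = 0"
  by (metis partner_0 partner_partner)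

lemma partner_eq_iff: "partner i = j \<longleftrightarrow> i = partner j"
  by (metis partner_partner)

lemma partner_eq_0_1 [simp]: "partner i = 0 \<longleftrightarrow> i = 1" "partner i = 1 \<longleftrightarrow> i = 0"
  by (simp_all add: partner_eq_iff partner_0 partner_1)

lemma sum_partner:
  "(\<Sum>i\<in>-{0,1}. f (partner i)) = (\<Sum>i\<in>-{0,1}. f (i :: 'n::finite bit0))"
  by (rule sum.reindex_bij_witness[of _ partner partner]) auto


section \<open>The dual metric and the almost complex structure in coordinates\<close>

lemma pw_frame_nth:
  "pw_T H x $ 0 = (H x + 1) / 2" "pw_T H x $ 1 = - 1"
  "pw_Z H x $ 0 = (H x - 1) / 2" "pw_Z H x $ 1 = - 1"
  "i \<noteq> 0 \<Longrightarrow> i \<noteq> 1 \<Longrightarrow> pw_T H x $ i = 0" "i \<noteq> 0 \<Longrightarrow> i \<noteq> 1 \<Longrightarrow> pw_Z H x $ i = 0"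
  by (simp_all add: pw_T_def pw_Z_def partial_v_def partial_u_def axis_def)

lemma flat_pw_T: "flat (pw_metric H) (pw_T H) x w = (1 - H x) / 2 * w $ 1 - w $ 0"
proof -
  have "(\<Sum>i\<in>-{0,1}. pw_T H x $ i * w $ i) = 0"
    by (intro sum.neutral) (simp add: pw_frame_nth)
  then show ?thesis
    by (simp add: flat_def pw_metric_def pw_frame_nth field_simps)
qed

text \<open>Twice the square of (1 - H)/2 du - dv is added: \<open>du^2\<close> gets H + (1 - H)^2/2
  = (1 + H^2)/2, and the mixed coefficient becomes 1 - (1 - H) = H.\<close>

lemma riemannian_dual_pw:
  "riemannian_dual (pw_metric H) (pw_T H) x a b =
     2 * (a $ 0 * b $ 0) + H x * (a $ 0 * b $ 1 + a $ 1 * b $ 0)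
     + (1 + H x * H x) / 2 * (a $ 1 * b $ 1) + (\<Sum>i\<in>-{0,1}. a $ i * b $ i)"
  by (simp add: riemannian_dual_def flat_pw_T pw_metric_def field_simps)

text \<open>The first two rows solve JT = Z, JZ = -T: they encode J \<partial>_v = T + Z and J
  \<partial>_u = (H - 1)/2 Z + (H + 1)/2 T.\<close>

definition pw_J :: "(real^('n::finite bit0) \<Rightarrow> real) \<Rightarrow> real^('n bit0) \<Rightarrow> real^('n bit0) \<Rightarrow> real^('n bit0)"
  where "pw_J H x w =
    (\<chi> i. if i = 0 then H x * w $ 0 + (H x * H x + 1) / 2 * w $ 1
          else if i = 1 then - 2 * w $ 0 - H x * w $ 1
          else partner_sign i * w $ partner i)"

lemma pw_J_nth:
  "pw_J H x w $ 0 = H x * w $ 0 + (H x * H x + 1) / 2 * w $ 1"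
  "pw_J H x w $ 1 = - 2 * w $ 0 - H x * w $ 1"
  "i \<noteq> 0 \<Longrightarrow> i \<noteq> 1 \<Longrightarrow> pw_J H x w $ i = partner_sign i * w $ partner i"
  by (simp_all add: pw_J_def)

lemma vec_eq_0_1_iff:
  fixes a b :: "real^('n::finite bit0)"
  shows "a = b \<longleftrightarrow> a $ 0 = b $ 0 \<and> a $ 1 = b $ 1 \<and> (\<forall>i. i \<noteq> 0 \<longrightarrow> i \<noteq> 1 \<longrightarrow> a $ i = b $ i)"
  by (metis vec_eq_iff)

lemma linear_pw_J: "linear (pw_J H x)"
  by (rule linearI) (simp_all add: vec_eq_0_1_iff pw_J_nth algebra_simps add_divide_distrib)

text \<open>The (v, u) block has trace 0 and determinant 1, so it squares to -1; elsewhere the two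
  signs met along a pair are opposite.\<close>

lemma pw_J_pw_J: "pw_J H x (pw_J H x w) = - w"
  by (simp add: vec_eq_0_1_iff pw_J_nth field_simps)

lemma smooth_on_pw_J:
  assumes "open W" "smooth_on W H"
  shows "smooth_on W (\<lambda>x. pw_J H x w)"
proof -
  \<comment> \<open>The zero profile isolates the part of \<open>pw_J\<close> that is constant in
    \<open>H\<close>; its base point can then be frozen at 0.\<close>
  have "(\<lambda>x. pw_J H x w) = (\<lambda>x. (H x * H x) *\<^sub>R axis 0 (w $ 1 / 2)
      + H x *\<^sub>R (axis 0 (w $ 0) - axis 1 (w $ 1)) + pw_J (\<lambda>_. 0) x w)"
    by (auto simp: fun_eq_iff vec_eq_0_1_iff pw_J_nth axis_def field_simps)
  also have "\<dots> = (\<lambda>x. (H x * H x) *\<^sub>R axis 0 (w $ 1 / 2)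
      + H x *\<^sub>R (axis 0 (w $ 0) - axis 1 (w $ 1)) + pw_J (\<lambda>_. 0) 0 w)"
    by (simp add: pw_J_def)
  finally show ?thesis
    using smooth_on_quadratic[OF assms] by simp
qed

lemma almost_complex_structure_pw_J:
  assumes "open W" "smooth_on W H"
  shows "almost_complex_structure_on W (pw_J H)"
  by (simp add: almost_complex_structure_on_def linear_pw_J smooth_on_pw_J[OF assms] pw_J_pw_J)

lemma frame_endomorphism_pw_J: "frame_endomorphism W H (pw_J H)"
proof -
  have "pw_J H x (partial_x (2 * k - 1)) = partial_x (2 * k)"
    and "pw_J H x (partial_x (2 * k)) = - partial_x (2 * k - 1)"
    if k: "k \<in> {2..CARD('a)}" for x k
  proof -
    \<comment> \<open>The coordinate x^j has index j - 1, hence the shift by one.\<close>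
    define i j :: "'a bit0" where "i = of_nat (2 * k - 2)" and "j = of_nat (2 * k - 1)"
    have "2 * k - 1 = Suc (2 * k - 2)"
      using k by auto
    then have "j = i + 1"
      unfolding i_def j_def by (simp only: of_nat_Suc add.commute)
    moreover have "even_index i"
    proof -
      have "even (2 * k - 2)" by simp
      then show ?thesis by (simp only: i_def even_index_of_nat)
    qed
    ultimately have ij: "partner i = j" "partner j = i" "partner_sign i = - 1" "partner_sign j = 1"
      by (auto simp: partner_def partner_sign_def even_index_add1)
    \<comment> \<open>From 2 \<le> k \<le> n follows 0 < 2k - 2 < 2n, so nothing wraps around to
      0.\<close>
    have "i \<noteq> 0"
    proof -
      have "Rep_bit0 i = int (2 * k - 2) mod int CARD('a bit0)"
        unfolding i_def bit0.of_nat_eq by (rule bit0.Rep_Abs_mod)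
      also have "\<dots> = int (2 * k - 2)"
        using k by (intro mod_pos_pos_trivial) auto
      also have "\<dots> \<noteq> 0"
        using k by auto
      finally show ?thesis using bit0.Rep_0 by blast
    qed
    have "i \<noteq> 1"
      using \<open>even_index i\<close> even_index_add1[of 0] even_index_0 by auto
    have j: "j \<noteq> 0" "j \<noteq> 1"
      using ij(2) \<open>i \<noteq> 0\<close> \<open>i \<noteq> 1\<close> partner_0 partner_1 by metis+
    have x: "partial_x (2 * k - 1) = axis i (1 :: real)" "partial_x (2 * k) = axis j (1 :: real)"
      by (simp_all add: partial_x_def i_def j_def numeral_2_eq_2)
    have partner_iff: "partner l = i \<longleftrightarrow> l = j" "partner l = j \<longleftrightarrow> l = i" for l
      using ij by (metis partner_partner)+
    have J: "pw_J H x (axis i 1) = axis j 1" "pw_J H x (axis j 1) = - axis i 1"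
      using \<open>i \<noteq> 0\<close> \<open>i \<noteq> 1\<close> j ij(3,4)
      by (simp_all add: vec_eq_0_1_iff pw_J_nth axis_def partner_iff)
    show "pw_J H x (partial_x (2 * k - 1)) = partial_x (2 * k)"
      and "pw_J H x (partial_x (2 * k)) = - partial_x (2 * k - 1)"
      unfolding x by (rule J)+
  qed
  moreover have "pw_J H x (pw_T H x) = pw_Z H x" "pw_J H x (pw_Z H x) = - pw_T H x" for x
    by (simp_all add: vec_eq_0_1_iff pw_J_nth pw_frame_nth field_simps)
  ultimately show ?thesis
    by (simp add: frame_endomorphism_def linear_pw_J)
qed

text \<open>The prescribed vectors span: \<partial>_v and \<partial>_u are combinations of T and Z,
  and the remaining basis vectors are prescribed directly.\<close>

lemma frame_endomorphism_unique:
  fixes H :: "real^('n::finite bit0) \<Rightarrow> real"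
  assumes "frame_endomorphism W H J" "frame_endomorphism W H J'" "x \<in> W"
  shows "J x = J' x"
proof -
  have lin: "linear (J x)" "linear (J' x)"
    using assms by (auto simp: frame_endomorphism_def)
  have T: "J x (pw_T H x) = J' x (pw_T H x)" and Z: "J x (pw_Z H x) = J' x (pw_Z H x)"
    using assms by (auto simp: frame_endomorphism_def)
  have v: "axis 0 1 = pw_T H x - pw_Z H x"
    and u: "axis 1 1 = ((H x - 1) / 2) *\<^sub>R pw_T H x - ((H x + 1) / 2) *\<^sub>R pw_Z H x"
    by (simp_all add: vec_eq_0_1_iff pw_frame_nth axis_def field_simps)
  have "J x (axis i 1) = J' x (axis i 1)" for i
  proof -
    obtain m where m: "m < 2 * CARD('n)" "i = of_nat m" by (rule bit0_of_nat_surj)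
    consider "m = 0" | "m = 1" | "m \<ge> 2" by linarith
    then show ?thesis
    proof cases
      case 1
      with m v T Z lin show ?thesis by (simp add: linear_diff)
    next
      case 2
      with m u T Z lin show ?thesis by (simp add: linear_diff linear_scale)
    next
      case 3
      \<comment> \<open>The indices 2k - 2 and 2k - 1 form the k-th pair, the pair (v, u) being the
        first.\<close>
      define k where "k = m div 2 + 1"
      have k: "k \<in> {2..CARD('n)}" using m 3 by (auto simp: k_def)
      have "m = 2 * k - 1 - 1 \<or> m = 2 * k - 1" by (simp add: k_def) presburger
      then have "axis i 1 = partial_x (2 * k - 1) \<or> axis i 1 = partial_x (2 * k)"
        using m(2) by (auto simp: partial_x_def)
      then show ?thesis
        using k assms by (auto simp: frame_endomorphism_def)
    qed
  qed
  with lin show ?thesis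
    by (intro linear_eq_stdbasis) (auto simp: Basis_vec_def)
qed


section \<open>The almost Kaehler property\<close>

lemma bilinear_riemannian_dual_pw: "bilinear (riemannian_dual (pw_metric H) (pw_T H) x)"
  unfolding bilinear_def
  by (intro conjI allI linearI)
    (simp_all add: riemannian_dual_pw sum.distrib sum_distrib_left algebra_simps add_divide_distrib)

lemma riemannian_metric_pw:
  assumes "open W" "smooth_on W H"
  shows "riemannian_metric_on W (riemannian_dual (pw_metric H) (pw_T H))"
proof -
  let ?g = "riemannian_dual (pw_metric H) (pw_T H)"
  have "smooth_on W (\<lambda>x. ?g x v w)" for v w
  proof -
    have g: "(\<lambda>x. ?g x v w) = (\<lambda>x. (H x * H x) *\<^sub>R (v $ 1 * w $ 1 / 2)
        + H x *\<^sub>R (v $ 0 * w $ 1 + v $ 1 * w $ 0)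
        + (2 * (v $ 0 * w $ 0) + v $ 1 * w $ 1 / 2 + (\<Sum>i\<in>-{0,1}. v $ i * w $ i)))"
      by (simp add: fun_eq_iff riemannian_dual_pw field_simps)
    show ?thesis unfolding g by (rule smooth_on_quadratic[OF assms])
  qed
  moreover have "?g x v w = ?g x w v" for x v w
    by (simp add: riemannian_dual_pw algebra_simps)
  moreover have "0 < ?g x v v" if "v \<noteq> 0" for x v
  proof -
    let ?s = "\<Sum>i\<in>-{0,1}. v $ i * v $ i"
    \<comment> \<open>Completing the square in the (v, u) block makes definiteness visible.\<close>
    have g: "?g x v v = (2 * v $ 0 + H x * v $ 1)\<^sup>2 / 2 + (v $ 1)\<^sup>2 / 2 + ?s"
      by (simp add: riemannian_dual_pw power2_eq_square field_simps)
    have s: "0 \<le> ?s" by (intro sum_nonneg) simp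
    have "v = 0" if "?g x v v = 0"
    proof -
      have "(2 * v $ 0 + H x * v $ 1)\<^sup>2 = 0" "(v $ 1)\<^sup>2 = 0" "?s = 0"
        using that g s zero_le_power2[of "2 * v $ 0 + H x * v $ 1"] zero_le_power2[of "v $ 1"]
        by linarith+
      then show ?thesis
        by (simp add: vec_eq_0_1_iff sum_nonneg_eq_0_iff)
    qed
    moreover have "0 \<le> ?g x v v" using g s by simp
    ultimately show ?thesis using \<open>v \<noteq> 0\<close> by fastforce
  qed
  ultimately show ?thesis
    by (simp add: riemannian_metric_on_def smooth_symmetric_on_def smooth_bilinear_field_on_def
        bilinear_riemannian_dual_pw)
qed

text \<open>Beyond the first two coordinates \<open>pw_J\<close> permutes components up to sign,
  which reindexing by \<open>partner\<close> absorbs; the (v, u) block is a direct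
  computation.\<close>

lemma compatible_pw: "compatible_on W (riemannian_dual (pw_metric H) (pw_T H)) (pw_J H)"
proof -
  have "(\<Sum>i\<in>-{0,1}. pw_J H x v $ i * pw_J H x w $ i) = (\<Sum>i\<in>-{0,1}. v $ i * w $ i)" for x v w
  proof -
    have "(\<Sum>i\<in>-{0,1}. pw_J H x v $ i * pw_J H x w $ i) =
        (\<Sum>i\<in>-{0,1}. v $ partner i * w $ partner i)"
      by (rule sum.cong) (auto simp: pw_J_nth partner_sign_def)
    then show ?thesis using sum_partner[of "\<lambda>i. v $ i * w $ i"] by simp
  qed
  then show ?thesis
    by (simp add: compatible_on_def riemannian_dual_pw pw_J_nth field_simps)
qed

text \<open>The sum meets each pair from both ends with opposite signs, giving one wedge product per
  pair.\<close>

lemma fundamental_form_pw: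
  "fundamental_form (riemannian_dual (pw_metric H) (pw_T H)) (pw_J H) x a b =
     a $ 0 * b $ 1 - a $ 1 * b $ 0 + (\<Sum>i\<in>-{0,1}. partner_sign i * (a $ i * b $ partner i))"
proof -
  have "(\<Sum>i\<in>-{0,1}. a $ i * pw_J H x b $ i) =
      (\<Sum>i\<in>-{0,1}. partner_sign i * (a $ i * b $ partner i))"
    by (rule sum.cong) (auto simp: pw_J_nth)
  then show ?thesis
    by (simp add: fundamental_form_def riemannian_dual_pw pw_J_nth field_simps)
qed

lemma closed_fundamental_form_pw:
  assumes "open W"
  shows "closed_two_form_on W
    (fundamental_form (riemannian_dual (pw_metric H) (pw_T H)) (pw_J H))"
    (is "closed_two_form_on W ?\<omega>")
proof -
  have "bilinear (?\<omega> x)" for x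
    unfolding bilinear_def
    by (intro conjI allI linearI)
      (simp_all add: fundamental_form_pw sum.distrib sum_distrib_left algebra_simps)
  moreover have "?\<omega> x v v = 0" for x v
  proof -
    \<comment> \<open>Reindexing by \<open>partner\<close> flips every sign, so the sum equals its
      own negative and vanishes.\<close>
    have "(\<Sum>i\<in>-{0,1}. partner_sign i * (v $ i * v $ partner i)) =
        - (\<Sum>i\<in>-{0,1}. partner_sign i * (v $ i * v $ partner i))"
      using sum_partner[of "\<lambda>i. partner_sign i * (v $ i * v $ partner i)"]
      by (simp add: sum_negf algebra_simps)
    then show ?thesis by (simp add: fundamental_form_pw)
  qed
  ultimately show ?thesis
    by (simp add: closed_two_form_on_def smooth_bilinear_field_on_def ext_deriv2_def
        fundamental_form_pw smooth_on_const[OF assms])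
qed

theorem theorem3:
  fixes X :: "'m topology"
    and A :: "('m, 'n::finite bit0) chart set"
    and h :: "('m, 'n bit0) chart \<Rightarrow> (real^('n bit0)) bilinear_field"
    and p :: 'm
    and D E W :: "(real^('n bit0)) set"
    and hPW :: "(real^('n bit0)) bilinear_field"
    and \<psi> :: "real^('n bit0) \<Rightarrow> real^('n bit0)"
    and H :: "real^('n bit0) \<Rightarrow> real"
  assumes "2 \<le> CARD('n)"
    and "lorentzian_manifold X A h"
    and "p \<in> topspace X"
    and "plane_wave_limit A h p D hPW"
    and "plane_wave_coordinates D hPW E \<psi> W H"
  shows "\<exists>J. frame_endomorphism W H J \<and>
             (\<forall>J'. frame_endomorphism W H J' \<longrightarrow> (\<forall>x\<in>W. J' x = J x)) \<and>
             almost_kaehler_on W (riemannian_dual (pw_metric H) (pw_T H)) J"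
proof -
  have "open W" "smooth_on W H"
    using assms(5) by (auto simp: plane_wave_coordinates_def pw_profile_def)
  then have "almost_kaehler_on W (riemannian_dual (pw_metric H) (pw_T H)) (pw_J H)"
    by (simp add: almost_kaehler_on_def riemannian_metric_pw almost_complex_structure_pw_J
        compatible_pw closed_fundamental_form_pw)
  then show ?thesis
    using frame_endomorphism_pw_J frame_endomorphism_unique by blast
qed

end
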